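(* Assume that a Hamel basis of $\mathbb{R}$ over $\mathbb{Q}$ exists. Then there exist $\tau_{\mathcal{H}}$-continuous functions $f:\mathbb{R}\to\mathbb{R}$ that are $\mathbb{Q}$-continuous at no point of $\mathbb{R}$.
   Context: The existence of a Hamel basis (a basis of $\mathbb{R}$ as a $\mathbb{Q}$-vector space) is assumed in addition to ZF. A function $H:\mathbb{R}\to\mathbb{R}$ is additive if $H(x+y)=H(x)+H(y)$ for all $x,y$. $\tau_{\mathcal{H}}$ is the initial topology on $\mathbb{R}$ generated by all additive functions, i.e. the smallest topology making every additive $H$ continuous as a map from $(\mathbb{R},\tau_{\mathcal{H}})$ to $\mathbb{R}$ with the usual topology. A function is $\tau_{\mathcal{H}}$-continuous if it is continuous from $(\mathbb{R},\tau_{\mathcal{H}})$ to $\mathbb{R}$ with the usual topology. For real $y\neq z$ put $S(y,z)=\{qy+(1-q)z: q\in\mathbb{Q}\cap[0,1]\}$. $f:\mathbb{R}\to\mathbb{R}$ is $\mathbb{Q}$-continuous at $x$ from the left if there is $\epsilon>0$ such that for all $y,z$ with $x-\epsilon<y<z\le x$ there is a continuous (in the usual sense) function $f_{y,z}:[y,z]\to\mathbb{R}$ with $f_{y,z}(t)=f(t)$ for all $t\in S(y,z)$; from the right: analogously with $x\le y<z<x+\epsilon$. $f$ is $\mathbb{Q}$-continuous at $x$ if it is $\mathbb{Q}$-continuous at $x$ from both sides. *)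

theory Defs
  imports "HOL-Analysis.Analysis"
begin

definition hamel_basis :: "real set \<Rightarrow> bool" where
  "hamel_basis B \<longleftrightarrow>
     \<not> module.dependent (\<lambda>(q::rat) (x::real). of_rat q * x) B \<and>
     module.span (\<lambda>(q::rat) (x::real). of_rat q * x) B = UNIV"

text \<open>The constants \<^const>\<open>module.dependent\<close> and \<^const>\<open>module.span\<close> only have their
  intended meaning because of the following fact.\<close>

lemma vector_space_real_over_rat: "vector_space (\<lambda>(q::rat) (x::real). of_rat q * x)"
  by unfold_locales (simp_all add: algebra_simps of_rat_add of_rat_mult)

text \<open>The qualifier in \<^const>\<open>Modules.additive\<close> is needed: the unqualified name denotes
  additivity of set functions.\<close>

definition tau_H :: "real topology" where
  "tau_H = topology_generated_by {H -` U | (H :: real \<Rightarrow> real) U. Modules.additive H \<and> open U}"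

lemma topspace_tau_H [simp]: "topspace tau_H = UNIV"
proof -
  have "Modules.additive (\<lambda>x::real. x)"
    by (simp add: Modules.additive_def)
  then have "UNIV \<in> {H -` U | (H :: real \<Rightarrow> real) (U :: real set). Modules.additive H \<and> open U}"
    by (intro CollectI exI[of _ "\<lambda>x. x"] exI[of _ UNIV]) auto
  then show ?thesis
    unfolding tau_H_def by (simp only: topology_generated_by_topspace) blast
qed

text \<open>The next two lemmas say that \<^const>\<open>tau_H\<close> is the coarsest topology on the reals making
  every additive function continuous.\<close>

lemma continuous_map_tau_H_additive:
  assumes "Modules.additive (H :: real \<Rightarrow> real)"
  shows "continuous_map tau_H euclidean H"
proof -
  have "openin tau_H (H -` U)" if "open U" for U
    unfolding tau_H_def using assms that by (intro topology_generated_by_Basis) blast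
  then show ?thesis
    by (auto simp: continuous_map vimage_def)
qed

lemma tau_H_coarsest:
  assumes "topspace T = UNIV"
    and "\<And>H :: real \<Rightarrow> real. Modules.additive H \<Longrightarrow> continuous_map T euclidean H"
    and "openin tau_H V"
  shows "openin T V"
proof -
  let ?S = "{H -` U | (H :: real \<Rightarrow> real) U. Modules.additive H \<and> open U}"
  have sub: "openin T s" if "s \<in> ?S" for s
  proof -
    from that obtain H :: "real \<Rightarrow> real" and U
      where s: "s = H -` U" and H: "Modules.additive H" and U: "open U" by blast
    have "openin T {x \<in> topspace T. H x \<in> U}"
      using assms(2)[OF H] U by (intro openin_continuous_map_preimage[where Y = euclidean]) auto
    then show ?thesis
      by (simp add: s assms(1) vimage_def)
  qed
  have "generate_topology_on ?S V"
    using assms(3) unfolding tau_H_def by (rule openin_topology_generated_by)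
  then show ?thesis
  proof (induction rule: generate_topology_on.induct)
    case (Basis s)
    then show ?case by (rule sub)
  qed auto
qed

definition tau_H_continuous :: "(real \<Rightarrow> real) \<Rightarrow> bool" where
  "tau_H_continuous f \<longleftrightarrow> continuous_map tau_H euclidean f"

definition Q_segment :: "real \<Rightarrow> real \<Rightarrow> real set" where
  "Q_segment y z = {q * y + (1 - q) * z | q. q \<in> \<rat> \<inter> {0..1}}"

definition Q_continuous_left :: "(real \<Rightarrow> real) \<Rightarrow> real \<Rightarrow> bool" where
  "Q_continuous_left f x \<longleftrightarrow>
     (\<exists>\<epsilon>>0. \<forall>y z. x - \<epsilon> < y \<and> y < z \<and> z \<le> x \<longrightarrow>
        (\<exists>g. continuous_on {y..z} g \<and> (\<forall>t\<in>Q_segment y z. g t = f t)))"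

definition Q_continuous_right :: "(real \<Rightarrow> real) \<Rightarrow> real \<Rightarrow> bool" where
  "Q_continuous_right f x \<longleftrightarrow>
     (\<exists>\<epsilon>>0. \<forall>y z. x \<le> y \<and> y < z \<and> z < x + \<epsilon> \<longrightarrow>
        (\<exists>g. continuous_on {y..z} g \<and> (\<forall>t\<in>Q_segment y z. g t = f t)))"

definition Q_continuous_at :: "(real \<Rightarrow> real) \<Rightarrow> real \<Rightarrow> bool" where
  "Q_continuous_at f x \<longleftrightarrow> Q_continuous_left f x \<and> Q_continuous_right f x"

end

theory Submission
  imports Defs
begin

text \<open>
  An additive function is \<open>\<rat>\<close>-linear, so along a rational segment from \<open>y\<close> to \<open>z\<close> it is the affine
  function \<open>q \<mapsto> q H(y) + (1 - q) H(z)\<close> of the rational parameter. Composing one such \<open>H\<close> with a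
  continuous function on all of \<open>\<real>\<close> can therefore never destroy \<open>\<rat>\<close>-continuity. The way out is
  to make \<open>H\<close> miss some reals: the coordinate of \<open>x\<close> at a fixed vector of a Hamel basis is an
  additive function with only rational values, so the outer function may have a pole at \<open>sqrt 2\<close>.
  The counterexample is \<open>f(x) = 1 / (H(x) - sqrt 2)\<close>.

  The function is \<open>\<tau>\<^sub>H\<close>-continuous because the denominator never vanishes. It is not
  \<open>\<rat>\<close>-continuous at any point because every fibre of \<open>H\<close> over a rational is dense
  (\<open>rational_fibre_dense\<close>): arbitrarily close to any point, and on its left, there are \<open>y < z\<close>
  with \<open>H(y) = 1\<close> and \<open>H(z) = 2\<close>. Along the rational segment between them \<open>H\<close> takes every rational
  value in \<open>[1, 2]\<close>, so \<open>f\<close> is unbounded there (\<open>pole_unbounded_on_Q_segment\<close>), whereas a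
  continuous function on \<open>[y, z]\<close> is bounded.
\<close>

text \<open>Values in \<^typ>\<open>rat\<close> rather than \<^typ>\<open>real\<close> record that the functional avoids the
  irrational numbers.\<close>

definition rational_functional :: "(real \<Rightarrow> rat) \<Rightarrow> bool" where
  "rational_functional H \<longleftrightarrow>
     (\<forall>x y. H (x + y) = H x + H y) \<and> (\<forall>q x. H (of_rat q * x) = q * H x)"

lemma sqrt_2_neq_of_rat: "sqrt 2 \<noteq> of_rat r"
proof
  assume "sqrt 2 = of_rat r"
  then have "sqrt 2 \<in> \<rat>" by simp
  then obtain m n :: nat where n: "n \<noteq> 0" and mn: "\<bar>sqrt 2\<bar> = m / n" and "coprime m n"
    by (rule Rats_abs_nat_div_natE)
  have "real m = sqrt 2 * n"
    using n mn by (simp add: field_simps)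
  then have "(real m)\<^sup>2 = 2 * (real n)\<^sup>2"
    by (simp add: power_mult_distrib)
  then have eq: "m\<^sup>2 = 2 * n\<^sup>2"
    using of_nat_eq_iff[where 'a = real, of "m\<^sup>2" "2 * n\<^sup>2"] by simp
  then have "even (m\<^sup>2)" by simp
  then have "even m" by simp
  then obtain k where "m = 2 * k" ..
  with eq have "n\<^sup>2 = 2 * k\<^sup>2"
    by (simp add: power_mult_distrib)
  then have "even (n\<^sup>2)" by simp
  then have "even n" by simp
  with \<open>even m\<close> \<open>coprime m n\<close> show False
    using coprime_common_divisor by fastforce
qed

text \<open>Hamel bases enter only here: the functional is the coordinate at a basis vector.\<close>

lemma hamel_basis_imp_rational_functional:
  assumes "hamel_basis B"
  obtains H b where "rational_functional H" "H b = 1"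
proof -
  interpret V: vector_space "\<lambda>(q::rat) (x::real). of_rat q * x"
    by (rule vector_space_real_over_rat)
  have ind: "V.independent B" and span: "V.span B = UNIV"
    using assms by (simp_all add: hamel_basis_def)
  have "B \<noteq> {}"
  proof
    assume "B = {}"
    then have "(1::real) \<in> {0}"
      using span V.span_empty by blast
    then show False by simp
  qed
  then obtain b where b: "b \<in> B" by blast
  define H where "H x = V.representation B x b" for x
  have "rational_functional H"
    unfolding rational_functional_def H_def
    using ind span by (simp add: V.representation_add V.representation_scale)
  moreover have "H b = 1"
    using V.representation_basis[OF ind b] by (simp add: H_def)
  ultimately show thesis by (rule that)
qed

text \<open>A nonzero rational-valued functional cannot be injective: for \<open>p = H (sqrt 2 * b)\<close>, the vector
  \<open>(sqrt 2 - p) * b\<close> lies in the kernel and is nonzero. Its rational multiples are dense and may be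
  added to \<open>c * b\<close> without changing the value \<open>c\<close>.\<close>

lemma rational_fibre_dense:
  assumes H: "rational_functional H" and b: "H b = 1" and "u < v"
  obtains t where "u < t" "t < v" "H t = c"
proof -
  have add: "H (x + y) = H x + H y" and scale: "H (of_rat q * x) = q * H x" for x y q
    using H by (auto simp: rational_functional_def)
  define k where "k = sqrt 2 * b + of_rat (- H (sqrt 2 * b)) * b"
  have Hk: "H k = 0"
    by (simp only: k_def add scale b)
  have "b \<noteq> 0"
    using b scale[of 0 0] by auto
  have "sqrt 2 \<noteq> of_rat (H (sqrt 2 * b))"
    by (rule sqrt_2_neq_of_rat)
  with \<open>b \<noteq> 0\<close> have "k \<noteq> 0"
    by (simp add: k_def of_rat_minus)
  have "H \<bar>k\<bar> = 0"
    using Hk scale[of "-1" k] by (auto simp: abs_if of_rat_minus)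
  have "(u - of_rat c * b) / \<bar>k\<bar> < (v - of_rat c * b) / \<bar>k\<bar>"
    using \<open>u < v\<close> \<open>k \<noteq> 0\<close> by (simp add: divide_strict_right_mono)
  then obtain r where r: "(u - of_rat c * b) / \<bar>k\<bar> < of_rat r" "of_rat r < (v - of_rat c * b) / \<bar>k\<bar>"
    using of_rat_dense by blast
  show thesis
  proof
    show "u < of_rat c * b + of_rat r * \<bar>k\<bar>" "of_rat c * b + of_rat r * \<bar>k\<bar> < v"
      using r \<open>k \<noteq> 0\<close> by (simp_all add: field_simps)
    show "H (of_rat c * b + of_rat r * \<bar>k\<bar>) = c"
      by (simp add: add scale b \<open>H \<bar>k\<bar> = 0\<close>)
  qed
qed

lemma pole_unbounded_on_Q_segment:
  assumes H: "rational_functional H" and y: "H y = 1" and z: "H z = 2"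
  obtains t where "t \<in> Q_segment y z" "1 / (of_rat (H t) - sqrt 2) > (M::real)"
proof -
  have add: "H (x + y) = H x + H y" and scale: "H (of_rat q * x) = q * H x" for x y q
    using H by (auto simp: rational_functional_def)
  have s: "1 < sqrt 2" "sqrt 2 < 2"
    by (simp_all add: real_less_lsqrt)
  define d where "d = 1 / (\<bar>M\<bar> + 1)"
  have "d > 0" by (simp add: d_def add_nonneg_pos)
  then have "sqrt 2 < min 2 (sqrt 2 + d)"
    using s by simp
  then obtain h where "sqrt 2 < of_rat h" "of_rat h < min 2 (sqrt 2 + d)"
    using of_rat_dense by blast
  then have h: "sqrt 2 < of_rat h" "of_rat h < (2::real)" "of_rat h - sqrt 2 < d"
    by auto
  \<comment> \<open>At the rational parameter \<open>q = 2 - h\<close>, the value \<open>q * 1 + (1 - q) * 2\<close> of \<open>H\<close> is \<open>h\<close>.\<close>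
  define t where "t = of_rat (2 - h) * y + of_rat (1 - (2 - h)) * z"
  have "H t = h"
    by (simp only: t_def add scale y z) simp
  have "of_rat 1 < (of_rat h :: real)" "of_rat h < (of_rat 2 :: real)"
    using less_trans[OF s(1) h(1)] h(2) by (simp_all only: of_rat_1 of_rat_numeral_eq)
  then have "1 < h" "h < 2"
    by (simp_all only: of_rat_less)
  have "t \<in> Q_segment y z"
    unfolding Q_segment_def t_def
  proof (intro CollectI exI[of _ "of_rat (2 - h)"] conjI IntI)
    show "of_rat (2 - h) \<in> {0..1::real}"
      using \<open>1 < h\<close> \<open>h < 2\<close> by simp
  qed (simp_all add: of_rat_diff)
  moreover have "1 / (of_rat (H t) - sqrt 2) > M"
  proof -
    have "1 / d < 1 / (of_rat h - sqrt 2)"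
      using h \<open>d > 0\<close> by (intro divide_strict_left_mono) auto
    then show ?thesis
      by (simp add: \<open>H t = h\<close> d_def)
  qed
  ultimately show thesis by (rule that)
qed

lemma pole_tau_H_continuous:
  assumes "rational_functional H"
  shows "tau_H_continuous (\<lambda>x. 1 / (of_rat (H x) - sqrt 2))"
proof -
  have "Modules.additive (\<lambda>x. of_rat (H x) :: real)"
    using assms by (simp add: Modules.additive_def rational_functional_def of_rat_add)
  then have "continuous_map tau_H euclidean (\<lambda>x. of_rat (H x) :: real)"
    by (rule continuous_map_tau_H_additive)
  moreover have "of_rat (H x) \<noteq> sqrt 2" for x
    using sqrt_2_neq_of_rat by (rule not_sym)
  ultimately show ?thesis
    unfolding tau_H_continuous_def
    by (intro continuous_map_real_divide continuous_map_diff) auto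
qed

lemma pole_not_Q_continuous_left:
  assumes H: "rational_functional H" and b: "H b = 1"
  shows "\<not> Q_continuous_left (\<lambda>x. 1 / (of_rat (H x) - sqrt 2)) x"
proof
  assume "Q_continuous_left (\<lambda>x. 1 / (of_rat (H x) - sqrt 2)) x"
  then obtain \<epsilon> where "\<epsilon> > 0" and ext: "\<And>y z. x - \<epsilon> < y \<Longrightarrow> y < z \<Longrightarrow> z \<le> x \<Longrightarrow>
      \<exists>g. continuous_on {y..z} g \<and> (\<forall>t\<in>Q_segment y z. g t = 1 / (of_rat (H t) - sqrt 2))"
    unfolding Q_continuous_left_def by metis
  obtain y where y: "x - \<epsilon> < y" "y < x" "H y = 1"
    using rational_fibre_dense[OF H b, of "x - \<epsilon>" x 1] \<open>\<epsilon> > 0\<close> by auto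
  obtain z where z: "y < z" "z < x" "H z = 2"
    using rational_fibre_dense[OF H b \<open>y < x\<close>, of 2] by auto
  obtain g where g: "continuous_on {y..z} g"
      "\<And>t. t \<in> Q_segment y z \<Longrightarrow> g t = 1 / (of_rat (H t) - sqrt 2)"
    using ext[of y z] y z by auto
  have "bounded (g ` {y..z})"
    using g(1) by (intro compact_imp_bounded compact_continuous_image) auto
  then obtain M where M: "\<forall>t\<in>{y..z}. \<bar>g t\<bar> \<le> M"
    by (auto simp: bounded_iff)
  obtain t where t: "t \<in> Q_segment y z" "1 / (of_rat (H t) - sqrt 2) > M"
    using pole_unbounded_on_Q_segment[OF H y(3) z(3)] by blast
  have "t \<in> {y..z}"
  proof -
    obtain q where q: "0 \<le> q" "q \<le> 1" "t = q * y + (1 - q) * z"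
      using t(1) by (auto simp: Q_segment_def)
    have "t - y = (1 - q) * (z - y)"
      by (simp add: q(3) algebra_simps)
    moreover have "z - t = q * (z - y)"
      by (simp add: q(3) algebra_simps)
    moreover have "0 \<le> (1 - q) * (z - y)" "0 \<le> q * (z - y)"
      using q z by simp_all
    ultimately have "0 \<le> t - y" "0 \<le> z - t" by argo+
    then show ?thesis by simp
  qed
  then show False
    using M g(2)[OF t(1)] t(2) by fastforce
qed

theorem theorem9p7:
  assumes "\<exists>B. hamel_basis B"
  shows "\<exists>f :: real \<Rightarrow> real. tau_H_continuous f \<and> (\<forall>x. \<not> Q_continuous_at f x)"
proof -
  obtain H b where "rational_functional H" "H b = 1"
    using assms hamel_basis_imp_rational_functional by metis
  then show ?thesis
    using pole_tau_H_continuous pole_not_Q_continuous_left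
    unfolding Q_continuous_at_def by blast
qed

end
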